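(* Let $f^- : \bar{X} \to \bar{Y}$ and $g^- : \bar{Y} \to \bar{Z}$ be arrows in the category $\mathbf{Prob}$. (1) For $v_1, v_2 \in \mathcal{L}^1(\bar{Y})$, $v_1 \sim_{\mathbb{P}_Y} v_2$ implies $E^{f^-}(v_1) \sim_{\mathbb{P}_X} E^{f^-}(v_2)$. (2) For $w \in \mathcal{L}^1(\bar{Z})$, $E^{f^-}(E^{g^-}(w)) \sim_{\mathbb{P}_X} E^{g^- \circ f^-}(w)$.
   Context: The category $\mathbf{Prob}$ has all probability spaces $\bar{X} = (X,\Sigma_X,\mathbb{P}_X)$ as objects; an arrow $f^- : \bar{X} \to \bar{Y}$ is a symbol corresponding uniquely to a measurable function $f : Y \to X$ (note the reversed direction) that is null-preserving, i.e. $\mathbb{P}_X(A)=0$ implies $\mathbb{P}_Y(f^{-1}(A))=0$ for $A \in \Sigma_X$. Composition is $g^- \circ f^- = (f \circ g)^-$. $\mathcal{L}^1(\bar{X})$ is the vector space of $\mathbb{R}$-valued random variables on $\bar{X}$ integrable with respect to $\mathbb{P}_X$. For random variables, $u_1 \sim_{\mathbb{P}_X} u_2$ means $\mathbb{P}_X(u_1 \ne u_2) = 0$. Conditional expectation along an arrow: for $f^- : \bar{X} \to \bar{Y}$ in $\mathbf{Prob}$ and $v \in \mathcal{L}^1(\bar{Y})$, $E^{f^-}(v)$ denotes the element of $\mathcal{L}^1(\bar{X})$, unique up to $\mathbb{P}_X$-a.s. equality (it exists by the Radon-Nikodym theorem), such that $\int_A E^{f^-}(v)\, d\mathbb{P}_X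 = \int_{f^{-1}(A)} v \, d\mathbb{P}_Y$ for all $A \in \Sigma_X$. *)

theory Defs
  imports "HOL-Probability.Probability"
begin

text \<open>
  An arrow \<open>X \<rightarrow> Y\<close> of \<open>Prob\<close> is represented by its underlying measurable
  function, which runs backwards from \<open>Y\<close> to \<open>X\<close>. A HOL function also has
  values outside \<open>space Y\<close>; nothing below depends on them, because every preimage is
  intersected with the space.
\<close>

definition prob_arrow :: "'a measure \<Rightarrow> 'b measure \<Rightarrow> ('b \<Rightarrow> 'a) \<Rightarrow> bool" where
  "prob_arrow X Y f \<longleftrightarrow>
     prob_space X \<and> prob_space Y \<and> f \<in> measurable Y X \<and>
     (\<forall>A\<in>sets X. measure X A = 0 \<longrightarrow> measure Y (f -` A \<inter> space Y) = 0)"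

text \<open>Arguments are in the order of arrows, first \<open>f : X \<rightarrow> Y\<close>, then
  \<open>g : Y \<rightarrow> Z\<close>, written \<open>prob_comp g f\<close>; the underlying functions compose the
  other way round.\<close>

definition prob_comp :: "('c \<Rightarrow> 'b) \<Rightarrow> ('b \<Rightarrow> 'a) \<Rightarrow> ('c \<Rightarrow> 'a)" where
  "prob_comp g f = f \<circ> g"

definition L1 :: "'a measure \<Rightarrow> ('a \<Rightarrow> real) set" where
  "L1 M = {v. integrable M v}"

text \<open>Membership in \<open>null_sets\<close> also asserts measurability of the set, so that the
  convention that non-measurable sets have measure 0 does no harm.\<close>

definition rv_equiv :: "'a measure \<Rightarrow> ('a \<Rightarrow> real) \<Rightarrow> ('a \<Rightarrow> real) \<Rightarrow> bool" where
  "rv_equiv M u v \<longleftrightarrow> {x \<in> space M. u x \<noteq> v x} \<in> null_sets M"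

definition is_cond_exp_along ::
    "'a measure \<Rightarrow> 'b measure \<Rightarrow> ('b \<Rightarrow> 'a) \<Rightarrow> ('b \<Rightarrow> real) \<Rightarrow> ('a \<Rightarrow> real) \<Rightarrow> bool" where
  "is_cond_exp_along X Y f v u \<longleftrightarrow>
     u \<in> L1 X \<and>
     (\<forall>A\<in>sets X. (\<integral>x\<in>A. u x \<partial>X) = (\<integral>y\<in>(f -` A \<inter> space Y). v y \<partial>Y))"

text \<open>A fixed but arbitrary version; that versions exist, and that any two of them are
  almost surely equal, is proved below.\<close>

definition cond_exp_along ::
    "'a measure \<Rightarrow> 'b measure \<Rightarrow> ('b \<Rightarrow> 'a) \<Rightarrow> ('b \<Rightarrow> real) \<Rightarrow> ('a \<Rightarrow> real)" where
  "cond_exp_along X Y f v = (SOME u. is_cond_exp_along X Y f v u)"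

lemma prob_arrow_comp:
  assumes "prob_arrow X Y f" "prob_arrow Y Z g"
  shows "prob_arrow X Z (prob_comp g f)"
proof -
  have f: "f \<in> measurable Y X" and g: "g \<in> measurable Z Y"
    using assms by (auto simp: prob_arrow_def)
  have "measure Z (prob_comp g f -` A \<inter> space Z) = 0"
    if A: "A \<in> sets X" "measure X A = 0" for A
  proof -
    have "measure Y (f -` A \<inter> space Y) = 0" "f -` A \<inter> space Y \<in> sets Y"
      using assms(1) A f by (auto simp: prob_arrow_def)
    then have "measure Z (g -` (f -` A \<inter> space Y) \<inter> space Z) = 0"
      using assms(2) by (auto simp: prob_arrow_def)
    moreover have "g -` (f -` A \<inter> space Y) \<inter> space Z = prob_comp g f -` A \<inter> space Z"
      using measurable_space[OF g] by (auto simp: prob_comp_def)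
    ultimately show ?thesis by simp
  qed
  then show ?thesis
    using assms f g by (auto simp: prob_arrow_def prob_comp_def)
qed

lemma is_cond_exp_along_unique:
  assumes "is_cond_exp_along X Y f v u" "is_cond_exp_along X Y f v u'"
  shows "rv_equiv X u u'"
proof -
  have int [measurable]: "integrable X u" "integrable X u'"
    using assms by (auto simp: is_cond_exp_along_def L1_def)
  have "AE x in X. u x = u' x"
    using assms by (intro density_unique_real int) (auto simp: is_cond_exp_along_def)
  moreover have "{x \<in> space X. u x \<noteq> u' x} \<in> sets X"
    by measurable
  ultimately show ?thesis
    by (auto simp: rv_equiv_def AE_iff_null)
qed

lemma is_cond_exp_along_exists_nonneg:
  assumes arr: "prob_arrow X Y f" and v: "v \<in> L1 Y" and nonneg: "\<And>y. 0 \<le> v y"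
  shows "\<exists>u. is_cond_exp_along X Y f v u"
proof -
  interpret X: prob_space X using arr by (simp add: prob_arrow_def)
  interpret Y: prob_space Y using arr by (simp add: prob_arrow_def)
  have f [measurable]: "f \<in> measurable Y X" using arr by (simp add: prob_arrow_def)
  have vi: "integrable Y v" using v by (simp add: L1_def)
  then have [measurable]: "v \<in> borel_measurable Y" by auto
  define N where "N = distr (density Y (\<lambda>y. ennreal (v y))) X f"
  have setsN: "sets N = sets X" by (simp add: N_def)
  have preim: "f -` A \<inter> space Y \<in> sets Y" if "A \<in> sets X" for A
    using that by measurable
  have vA: "integrable Y (\<lambda>y. indicator (f -` A \<inter> space Y) y * v y)" if "A \<in> sets X" for A
    using integrable_mult_indicator[OF preim[OF that] vi] by simp
  have eN: "emeasure N A = ennreal (\<integral>y\<in>(f -` A \<inter> space Y). v y \<partial>Y)"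
    if A: "A \<in> sets X" for A
  proof -
    have "emeasure N A = (\<integral>\<^sup>+y. ennreal (v y) * indicator (f -` A \<inter> space Y) y \<partial>Y)"
      unfolding N_def using A preim[OF A] by (simp add: emeasure_distr emeasure_density)
    also have "\<dots> = (\<integral>\<^sup>+y. ennreal (indicator (f -` A \<inter> space Y) y * v y) \<partial>Y)"
      by (intro nn_integral_cong) (auto split: split_indicator)
    also have "\<dots> = ennreal (\<integral>y. indicator (f -` A \<inter> space Y) y * v y \<partial>Y)"
      by (intro nn_integral_eq_integral vA A) (auto simp: nonneg)
    finally show ?thesis by (simp add: set_lebesgue_integral_def)
  qed
  have fin: "finite_measure N"
    by (rule finite_measureI) (simp add: eN sets_eq_imp_space_eq[OF setsN])
  have ac: "absolutely_continuous X N"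
    unfolding absolutely_continuous_def
  proof
    fix A assume A: "A \<in> null_sets X"
    then have "A \<in> sets X" "measure X A = 0" by (auto simp: measure_def)
    then have "measure Y (f -` A \<inter> space Y) = 0" using arr by (simp add: prob_arrow_def)
    then have "f -` A \<inter> space Y \<in> null_sets Y"
      using preim[OF \<open>A \<in> sets X\<close>] by (auto simp: Y.emeasure_eq_measure)
    then have "AE y in Y. y \<notin> f -` A \<inter> space Y" by (rule AE_not_in)
    then have "(\<integral>y. indicator (f -` A \<inter> space Y) y *\<^sub>R v y \<partial>Y) = 0"
      by (intro integral_eq_zero_AE) auto
    then show "A \<in> null_sets N"
      using \<open>A \<in> sets X\<close> eN[OF \<open>A \<in> sets X\<close>]
      by (auto simp: setsN set_lebesgue_integral_def)
  qed
  obtain D where D [measurable]: "D \<in> borel_measurable X"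
    and RN: "AE x in X. RN_deriv X N x = ennreal (D x)" and D0: "\<And>x. 0 \<le> D x"
    using X.real_RN_deriv[OF fin ac setsN] by metis
  have "density X (\<lambda>x. ennreal (D x)) = density X (RN_deriv X N)"
    using RN by (intro density_cong) auto
  also have "\<dots> = N" by (rule X.density_RN_deriv[OF ac setsN])
  finally have dens: "density X (\<lambda>x. ennreal (D x)) = N" .
  have nnD: "(\<integral>\<^sup>+x. ennreal (indicator A x * D x) \<partial>X)
      = ennreal (\<integral>y\<in>(f -` A \<inter> space Y). v y \<partial>Y)" if A: "A \<in> sets X" for A
  proof -
    have "(\<integral>\<^sup>+x. ennreal (indicator A x * D x) \<partial>X) = (\<integral>\<^sup>+x. ennreal (D x) * indicator A x \<partial>X)"
      by (intro nn_integral_cong) (auto split: split_indicator)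
    also have "\<dots> = emeasure N A"
      using A by (simp add: dens[symmetric] emeasure_density)
    finally show ?thesis using eN[OF A] by simp
  qed
  have v0: "0 \<le> (\<integral>y\<in>B. v y \<partial>Y)" for B
    unfolding set_lebesgue_integral_def by (rule Bochner_Integration.integral_nonneg) (auto simp: nonneg)
  have "(\<integral>x\<in>A. D x \<partial>X) = (\<integral>y\<in>(f -` A \<inter> space Y). v y \<partial>Y)" if A: "A \<in> sets X" for A
    unfolding set_lebesgue_integral_def[of X]
    using A nnD[OF A] v0 by (subst integral_eq_nn_integral) (auto simp: D0)
  moreover have "integrable X D"
  proof (rule integrableI_nonneg)
    have "(\<integral>\<^sup>+x. ennreal (D x) \<partial>X) = (\<integral>\<^sup>+x. ennreal (indicator (space X) x * D x) \<partial>X)"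
      by (intro nn_integral_cong) auto
    then show "(\<integral>\<^sup>+x. ennreal (D x) \<partial>X) < \<infinity>"
      using nnD[OF sets.top] by simp
  qed (auto simp: D0)
  ultimately show ?thesis
    by (auto simp: is_cond_exp_along_def L1_def)
qed

lemma set_integrable_of_integrable:
  fixes h :: "'a \<Rightarrow> real"
  assumes "integrable M h" "A \<in> sets M"
  shows "set_integrable M A h"
  using integrable_mult_indicator[OF assms(2,1)] by (simp add: set_integrable_def)

lemma is_cond_exp_along_exists:
  assumes arr: "prob_arrow X Y f" and v: "v \<in> L1 Y"
  shows "\<exists>u. is_cond_exp_along X Y f v u"
proof -
  have f [measurable]: "f \<in> measurable Y X" using arr by (simp add: prob_arrow_def)
  have vi: "integrable Y v" using v by (simp add: L1_def)
  define p where "p = (\<lambda>y. max 0 (v y))"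
  define n where "n = (\<lambda>y. max 0 (- v y))"
  have pn: "integrable Y p" "integrable Y n" unfolding p_def n_def using vi by auto
  obtain a where a: "is_cond_exp_along X Y f p a"
    using is_cond_exp_along_exists_nonneg[OF arr, of p] pn by (auto simp: L1_def p_def)
  obtain b where b: "is_cond_exp_along X Y f n b"
    using is_cond_exp_along_exists_nonneg[OF arr, of n] pn by (auto simp: L1_def n_def)
  have ab: "integrable X a" "integrable X b"
    using a b by (auto simp: is_cond_exp_along_def L1_def)
  have v_eq: "v = (\<lambda>y. p y - n y)" by (auto simp: p_def n_def)
  have "(\<integral>x\<in>A. (a x - b x) \<partial>X) = (\<integral>y\<in>(f -` A \<inter> space Y). v y \<partial>Y)" if A: "A \<in> sets X" for A
  proof -
    have B: "f -` A \<inter> space Y \<in> sets Y" using A by measurable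
    have "(\<integral>x\<in>A. (a x - b x) \<partial>X) = (\<integral>x\<in>A. a x \<partial>X) - (\<integral>x\<in>A. b x \<partial>X)"
      by (intro set_integral_diff(2) set_integrable_of_integrable ab A)
    also have "\<dots> = (\<integral>y\<in>(f -` A \<inter> space Y). p y \<partial>Y) - (\<integral>y\<in>(f -` A \<inter> space Y). n y \<partial>Y)"
      using a b A by (simp add: is_cond_exp_along_def)
    also have "\<dots> = (\<integral>y\<in>(f -` A \<inter> space Y). (p y - n y) \<partial>Y)"
      by (intro set_integral_diff(2)[symmetric] set_integrable_of_integrable pn B)
    finally show ?thesis by (simp add: v_eq)
  qed
  then have "is_cond_exp_along X Y f v (\<lambda>x. a x - b x)"
    using ab by (auto simp: is_cond_exp_along_def L1_def)
  then show ?thesis by blast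
qed

lemma is_cond_exp_along_cond_exp_along:
  assumes "prob_arrow X Y f" "v \<in> L1 Y"
  shows "is_cond_exp_along X Y f v (cond_exp_along X Y f v)"
  unfolding cond_exp_along_def using someI_ex[OF is_cond_exp_along_exists[OF assms]] .

end

theory Submission
  imports Defs
begin

text \<open>Integrals over measurable sets determine a version of the conditional expectation almost
  surely (\<open>is_cond_exp_along_unique\<close>), so it is enough to find one function that is a
  version for both sides. For (1), the defining equations see \<open>v\<close> only through
  integrals, which an almost sure change leaves alone (\<open>is_cond_exp_along_cong_AE\<close>).
  For (2), the equations along the two arrows chain together
  (\<open>is_cond_exp_along_comp\<close>). Null preservation enters through existence: it gives the
  absolute continuity that Radon-Nikodym needs.\<close>

lemma is_cond_exp_along_cong_AE:
  assumes arr: "prob_arrow X Y f" and v: "v1 \<in> L1 Y" "v2 \<in> L1 Y" and eq: "rv_equiv Y v1 v2"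
    and u: "is_cond_exp_along X Y f v1 u"
  shows "is_cond_exp_along X Y f v2 u"
proof -
  have f [measurable]: "f \<in> measurable Y X" using arr by (simp add: prob_arrow_def)
  have [measurable]: "v1 \<in> borel_measurable Y" "v2 \<in> borel_measurable Y"
    using v by (auto simp: L1_def)
  have ae: "AE y in Y. v1 y = v2 y"
    using eq by (intro AE_I') (auto simp: rv_equiv_def)
  have "(\<integral>y\<in>(f -` A \<inter> space Y). v1 y \<partial>Y) = (\<integral>y\<in>(f -` A \<inter> space Y). v2 y \<partial>Y)"
    if [measurable]: "A \<in> sets X" for A
    unfolding set_lebesgue_integral_def using ae by (intro integral_cong_AE) auto
  then show ?thesis using u by (simp add: is_cond_exp_along_def)
qed

text \<open>Tower property for arbitrary versions: since \<open>f\<close> is measurable, the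
  preimage of \<open>A\<close> under \<open>f\<close> is itself a test set for \<open>v\<close>, so
  the equation for \<open>u\<close> at \<open>A\<close> continues with the one for \<open>v\<close>
  at that preimage.\<close>

lemma is_cond_exp_along_comp:
  assumes f: "f \<in> measurable Y X" and g: "g \<in> measurable Z Y"
    and u: "is_cond_exp_along X Y f v u" and v: "is_cond_exp_along Y Z g w v"
  shows "is_cond_exp_along X Z (prob_comp g f) w u"
proof -
  \<comment> \<open>Cutting down to \<open>space Y\<close> loses nothing, as \<open>g\<close> maps
    \<open>space Z\<close> into it.\<close>
  have "g -` (f -` A \<inter> space Y) \<inter> space Z = prob_comp g f -` A \<inter> space Z" for A
    using measurable_space[OF g] by (auto simp: prob_comp_def)
  then show ?thesis
    using u v measurable_sets[OF f] by (simp add: is_cond_exp_along_def)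
qed

theorem proposition3p3:
  fixes X :: "'a measure" and Y :: "'b measure" and Z :: "'c measure"
    and f :: "'b \<Rightarrow> 'a" and g :: "'c \<Rightarrow> 'b"
  assumes "prob_arrow X Y f" and "prob_arrow Y Z g"
  shows "(\<forall>v1\<in>L1 Y. \<forall>v2\<in>L1 Y. rv_equiv Y v1 v2 \<longrightarrow>
            rv_equiv X (cond_exp_along X Y f v1) (cond_exp_along X Y f v2)) \<and>
         (\<forall>w\<in>L1 Z.
            rv_equiv X (cond_exp_along X Y f (cond_exp_along Y Z g w))
                       (cond_exp_along X Z (prob_comp g f) w))"
proof (intro conjI ballI impI)
  fix v1 v2 assume v: "v1 \<in> L1 Y" "v2 \<in> L1 Y" "rv_equiv Y v1 v2"
  show "rv_equiv X (cond_exp_along X Y f v1) (cond_exp_along X Y f v2)"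
    \<comment> \<open>The version chosen for \<open>v1\<close> is also one for \<open>v2\<close>,
      hence almost surely the chosen one.\<close>
    by (rule is_cond_exp_along_unique[OF is_cond_exp_along_cong_AE[OF assms(1) v]])
      (intro is_cond_exp_along_cond_exp_along assms(1) v)+
next
  fix w assume w: "w \<in> L1 Z"
  have E: "is_cond_exp_along Y Z g w (cond_exp_along Y Z g w)"
    by (intro is_cond_exp_along_cond_exp_along assms(2) w)
  \<comment> \<open>Integrability of the inner version guarantees that the outer one exists.\<close>
  then have "cond_exp_along Y Z g w \<in> L1 Y"
    by (simp add: is_cond_exp_along_def)
  from is_cond_exp_along_cond_exp_along[OF assms(1) this] E
  have "is_cond_exp_along X Z (prob_comp g f) w
      (cond_exp_along X Y f (cond_exp_along Y Z g w))"
    using assms by (intro is_cond_exp_along_comp) (auto simp: prob_arrow_def)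
  then show "rv_equiv X (cond_exp_along X Y f (cond_exp_along Y Z g w))
                       (cond_exp_along X Z (prob_comp g f) w)"
    by (rule is_cond_exp_along_unique)
      (intro is_cond_exp_along_cond_exp_along prob_arrow_comp[OF assms] w)
qed

end
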